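(* For all positive integers $n,k,\ell$, there exist a tree space $\mathcal{T}$ with $k$ leaves and a set $\mathcal{A}$ of at most $n$ trees in $\mathcal{T}$, each with at most $\ell$ leaves, such that every non-monochromatic coloring of $\mathcal{A}$ uses at least $\min\left(\ell+1,\left\lfloor \frac{1+\sqrt{1+8k}}{2}\right\rfloor, n\right)$ colors. In particular $\chi^{\mathrm{NM}}_{\mathrm{tree}}(\mathrm{trees};k,\ell;n)\ge \min\left(\ell+1,\left\lfloor \frac{1+\sqrt{1+8k}}{2}\right\rfloor, n\right)$.
   Context: A network space is a 1-dimensional space with the topology of a graph (nodes are points, edges are simple curves joining pairs of nodes, otherwise disjoint); a tree space is a network space whose underlying graph is a tree. A "tree" in a tree space $\mathcal{T}$ is a connected subset of $\mathcal{T}$; its leaves may lie in interiors of edges. For a set $\mathcal{A}$ of objects and a point $p$, $S_p=\{o\in\mathcal{A}:p\in o\}$. A coloring of $\mathcal{A}$ is non-monochromatic if for every point $p$ with $|S_p|\ge2$, the objects in $S_p$ do not all have the same color. $\chi^{\mathrm{NM}}_{\mathrm{tree}}(\mathrm{trees};k,\ell;n)$ denotes the minimum number of colors sufficient to NM-color any set of $n$ trees with at most $\ell$ leaves each in any tree space with at most $k$ leaves.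
   Formalization: When k = 1 or ℓ = 1 the trees in 𝒜 may coincide as point sets, since for n ≥ 2 the claim for a set of pairwise different trees then fails (one-leaf trees are points); for k, ℓ ≥ 2 the trees are distinct and the bound on χ is also proved for distinct trees. *)

theory Defs
  imports "HOL-Analysis.Analysis"
begin

text \<open>
  A network space is a topological space together with a finite set \<open>V\<close> of nodes and a finite set
  \<open>E\<close> of edges, an edge being the point set of a simple curve that joins two distinct nodes. The
  edges include their end nodes, so the underlying graph is the multigraph on \<open>V\<close> in which
  \<open>e \<in> E\<close> has the set of ends \<open>e \<inter> V\<close>. As there are finitely many compact edges, the Hausdorff
  condition makes the topology that of the graph, and an injective path is a simple curve.
\<close>

definition joins :: "'a set \<Rightarrow> 'a set \<Rightarrow> 'a \<Rightarrow> 'a \<Rightarrow> bool" where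
  "joins V e u v \<longleftrightarrow> u \<noteq> v \<and> e \<inter> V = {u, v}"

definition network_space :: "'a topology \<Rightarrow> 'a set \<Rightarrow> 'a set set \<Rightarrow> bool" where
  "network_space X V E \<longleftrightarrow>
     Hausdorff_space X \<and> finite V \<and> finite E \<and> topspace X = V \<union> \<Union>E \<and>
     (\<forall>e\<in>E. \<exists>g. pathin X g \<and> inj_on g {0..1} \<and> g ` {0..1} = e \<and> joins V e (g 0) (g 1)) \<and>
     (\<forall>e\<in>E. \<forall>e'\<in>E. e \<noteq> e' \<longrightarrow> e \<inter> e' \<subseteq> V)"

definition connected_graph :: "'a set \<Rightarrow> 'a set set \<Rightarrow> bool" where
  "connected_graph V E \<longleftrightarrow>
     V \<noteq> {} \<and> (\<forall>u\<in>V. \<forall>v\<in>V. (u, v) \<in> {(x, y). \<exists>e\<in>E. joins V e x y}\<^sup>*)"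

text \<open>Cycles of length 2, formed by two parallel edges, are included.\<close>

definition graph_cycle :: "'a set \<Rightarrow> 'a set set \<Rightarrow> 'a list \<Rightarrow> 'a set list \<Rightarrow> bool" where
  "graph_cycle V E vs es \<longleftrightarrow>
     2 \<le> length vs \<and> length es = length vs \<and> distinct vs \<and> distinct es \<and>
     set vs \<subseteq> V \<and> set es \<subseteq> E \<and>
     (\<forall>i<length vs. joins V (es ! i) (vs ! i) (vs ! (Suc i mod length vs)))"

definition tree_space :: "'a topology \<Rightarrow> 'a set \<Rightarrow> 'a set set \<Rightarrow> bool" where
  "tree_space X V E \<longleftrightarrow>
     network_space X V E \<and> connected_graph V E \<and> \<not> (\<exists>vs es. graph_cycle V E vs es)"

text \<open>
  The node of a one-point tree has degree 0 and counts as its single leaf.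
\<close>

definition leaves :: "'a set \<Rightarrow> 'a set set \<Rightarrow> 'a set" where
  "leaves V E = {v \<in> V. card {e \<in> E. v \<in> e} \<le> 1}"

text \<open>
  Different choices of nodes and edges for the same space differ only in nodes of degree 2,
  so the number of leaves depends on the space alone.
\<close>

definition tree_space_with_leaves :: "'a topology \<Rightarrow> nat \<Rightarrow> bool" where
  "tree_space_with_leaves X k \<longleftrightarrow> (\<exists>V E. tree_space X V E \<and> card (leaves V E) = k)"

text \<open>
  A tree in a tree space is a connected subset. To have leaves it must be a tree space
  in its own right, i.e. nonempty and closed; the nodes of the subspace need not be nodes of the
  ambient space, so its leaves may lie in the interiors of edges.
\<close>

definition tree_in :: "'a topology \<Rightarrow> nat \<Rightarrow> 'a set \<Rightarrow> bool" where
  "tree_in X l T \<longleftrightarrow>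
     connectedin X T \<and> (\<exists>j\<le>l. tree_space_with_leaves (subtopology X T) j)"

text \<open>
  The objects form a finite family: \<open>I\<close> is the set of objects and \<open>R i\<close> the set of points of the
  object \<open>i\<close>. Two objects may occupy the same point set unless \<open>inj_on R I\<close> is required.
\<close>

definition nm_coloring :: "'i set \<Rightarrow> ('i \<Rightarrow> 'a set) \<Rightarrow> ('i \<Rightarrow> 'c) \<Rightarrow> bool" where
  "nm_coloring I R col \<longleftrightarrow>
     (\<forall>p. let S = {i \<in> I. p \<in> R i} in 2 \<le> card S \<longrightarrow> \<not> (\<exists>c. \<forall>i\<in>S. col i = c))"

text \<open>
  A tree space has at most continuum many points, so up to homeomorphism every tree space
  is an (arbitrary, not necessarily Euclidean) topology on a subset of the complex numbers.
\<close>

definition chi_NM_tree :: "nat \<Rightarrow> nat \<Rightarrow> nat \<Rightarrow> nat" where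
  "chi_NM_tree k l n = (LEAST c.
     \<forall>(X :: complex topology) j (I :: nat set) R.
       j \<le> k \<and> tree_space_with_leaves X j \<and>
       finite I \<and> card I = n \<and> (\<forall>i\<in>I. tree_in X l (R i)) \<longrightarrow>
       (\<exists>col :: nat \<Rightarrow> nat. nm_coloring I R col \<and> card (col ` I) \<le> c))"

text \<open>The same number, restricted to pairwise different point sets.\<close>

definition chi_NM_tree_distinct :: "nat \<Rightarrow> nat \<Rightarrow> nat \<Rightarrow> nat" where
  "chi_NM_tree_distinct k l n = (LEAST c.
     \<forall>(X :: complex topology) j (I :: nat set) R.
       j \<le> k \<and> tree_space_with_leaves X j \<and>
       finite I \<and> card I = n \<and> inj_on R I \<and> (\<forall>i\<in>I. tree_in X l (R i)) \<longrightarrow>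
       (\<exists>col :: nat \<Rightarrow> nat. nm_coloring I R col \<and> card (col ` I) \<le> c))"

end

theory Submission
  imports Defs
begin

text \<open>
  Take \<open>m\<close> equal to the claimed bound. It satisfies \<open>m choose 2 \<le> k\<close>, so in a star with \<open>k\<close> arms
  every pair \<open>{i, j}\<close> of indices below \<open>m\<close> can be given an arm of its own. Let the tree \<open>R i\<close>
  consist of the \<open>m - 1 \<le> l\<close> arms whose pair contains \<open>i\<close>. A point off the center on the arm
  of \<open>{i, j}\<close> lies in \<open>R i\<close> and \<open>R j\<close> only, so these two trees need different colors. The
  family is filled up to \<open>n\<close> trees by segments at the center too short to reach that point, and
  all trees are made distinct by giving their arms different lengths. If one of \<open>n\<close>, \<open>k\<close>, \<open>l\<close>
  is 1, then \<open>m \<le> 2\<close> and \<open>n\<close> copies of one point suffice.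
\<close>

subsection \<open>Stars in the plane\<close>

text \<open>The ray of slope \<open>t\<close>, parametrized by real part rather than by distance:
  each natural number indexes a ray of its own, and membership becomes a condition on
  coordinates.\<close>

definition spoke :: "real \<Rightarrow> nat \<Rightarrow> complex" where
  "spoke s t = Complex s (s * real t)"

definition arm :: "real \<Rightarrow> nat \<Rightarrow> complex set" where
  "arm r t = {z. 0 \<le> Re z \<and> Re z \<le> r \<and> Im z = Re z * real t}"

text \<open>The center is inserted separately so that a star without arms is a point and not
  empty.\<close>

definition star :: "real \<Rightarrow> nat set \<Rightarrow> complex set" where
  "star r T = insert 0 (\<Union>t\<in>T. arm r t)"

lemma spoke_simps [simp]: "Re (spoke s t) = s" "Im (spoke s t) = s * real t" "spoke 0 t = 0"
  by (auto simp: spoke_def complex_eq_iff)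

lemma spoke_eq_iff: "s \<noteq> 0 \<Longrightarrow> spoke s t = spoke s' t' \<longleftrightarrow> s = s' \<and> t = t'"
  by (auto simp: complex_eq_iff)

lemma spoke_eq_0_iff [simp]: "spoke s t = 0 \<longleftrightarrow> s = 0"
  by (auto simp: complex_eq_iff)

lemma spoke_in_arm_iff: "s \<noteq> 0 \<Longrightarrow> spoke s t \<in> arm r t' \<longleftrightarrow> 0 \<le> s \<and> s \<le> r \<and> t = t'"
  by (auto simp: arm_def)

lemma zero_in_arm [simp]: "0 \<le> r \<Longrightarrow> 0 \<in> arm r t"
  by (auto simp: arm_def)

lemma spoke_in_star_iff: "s \<noteq> 0 \<Longrightarrow> spoke s t \<in> star r T \<longleftrightarrow> 0 \<le> s \<and> s \<le> r \<and> t \<in> T"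
  by (auto simp: star_def spoke_in_arm_iff)

lemma arm_eq_image: "arm r t = (\<lambda>s. spoke s t) ` {0..r}"
  by (force simp: arm_def image_iff complex_eq_iff)

lemma continuous_on_spoke: "continuous_on S f \<Longrightarrow> continuous_on S (\<lambda>x. spoke (f x) t)"
  unfolding spoke_def Complex_eq by (intro continuous_intros)

lemma arm_Int_arm: "t \<noteq> t' \<Longrightarrow> arm r t \<inter> arm r' t' \<subseteq> {0}"
  by (auto simp: arm_def complex_eq_iff)

lemma star_empty [simp]: "star r {} = {0}"
  by (simp add: star_def)

lemma star_mono: "r \<le> r' \<Longrightarrow> T \<subseteq> T' \<Longrightarrow> star r T \<subseteq> star r' T'"
  by (fastforce simp: star_def arm_def)

lemma connected_star:
  assumes "0 \<le> r"
  shows "connected (star r T)"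
proof -
  have "connected (\<Union> (insert {0} (arm r ` T)))"
  proof (rule connected_Union)
    fix S assume "S \<in> insert {0} (arm r ` T)"
    then show "connected S"
      by (auto simp: arm_eq_image intro!: connected_continuous_image continuous_on_spoke)
  next
    show "\<Inter> (insert {0} (arm r ` T)) \<noteq> {}"
      using assms by auto
  qed
  then show ?thesis by (simp add: star_def)
qed

section \<open>Stars as tree spaces\<close>

definition star_nodes :: "real \<Rightarrow> nat set \<Rightarrow> complex set" where
  "star_nodes r T = insert 0 (spoke r ` T)"

lemma arm_Int_star_nodes:
  "0 < r \<Longrightarrow> t \<in> T \<Longrightarrow> arm r t \<inter> star_nodes r T = {0, spoke r t}"
  by (auto simp: star_nodes_def spoke_in_arm_iff)

lemma joins_arm:
  assumes "0 < r" "t \<in> T"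
  shows "joins (star_nodes r T) (arm r t) u v \<longleftrightarrow> u \<noteq> v \<and> {u, v} = {0, spoke r t}"
  using assms by (auto simp: joins_def arm_Int_star_nodes)

lemma network_space_star:
  assumes "finite T" "0 < r"
  shows "network_space (top_of_set (star r T)) (star_nodes r T) (arm r ` T)"
  unfolding network_space_def
proof (intro conjI ballI impI)
  show "Hausdorff_space (top_of_set (star r T))"
    by (simp add: Hausdorff_space_subtopology)
  show "topspace (top_of_set (star r T)) = star_nodes r T \<union> \<Union> (arm r ` T)"
    using assms by (auto simp: star_def star_nodes_def spoke_in_arm_iff)
next
  fix e assume "e \<in> arm r ` T"
  then obtain t where t: "t \<in> T" "e = arm r t" by blast
  define g where "g = (\<lambda>s. spoke (s * r) t)"
  have img: "g ` {0..1} = e"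
  proof -
    have "(\<lambda>s. s * r) ` {0..1} = {0..r}"
      using assms(2) by (force simp: image_iff divide_simps intro: bexI[of _ "_ / r"])
    then show ?thesis
      by (simp add: g_def t arm_eq_image flip: image_image[of "\<lambda>s. spoke s t" "\<lambda>s. s * r"])
  qed
  have "pathin (top_of_set (star r T)) g"
    using img t by (auto simp: pathin_def continuous_map_in_subtopology star_def g_def
        intro!: continuous_on_spoke continuous_intros)
  moreover have "inj_on g {0..1}"
    using assms(2) by (auto simp: inj_on_def g_def complex_eq_iff)
  moreover have "joins (star_nodes r T) e (g 0) (g 1)"
    using assms t by (simp add: joins_arm g_def eq_commute[of 0])
  ultimately show "\<exists>g. pathin (top_of_set (star r T)) g \<and> inj_on g {0..1} \<and> g ` {0..1} = e \<and>
      joins (star_nodes r T) e (g 0) (g 1)"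
    using img by blast
next
  fix e e' assume "e \<in> arm r ` T" "e' \<in> arm r ` T" "e \<noteq> e'"
  then obtain t t' where "e = arm r t" "e' = arm r t'" "t \<noteq> t'" by blast
  then show "e \<inter> e' \<subseteq> star_nodes r T"
    using arm_Int_arm[of t t' r r] by (auto simp: star_nodes_def)
qed (use assms in \<open>auto simp: star_nodes_def\<close>)

text \<open>Every node is linked to the center in both directions, so any two nodes are linked
  through it.\<close>

lemma connected_graph_star:
  assumes "0 < r"
  shows "connected_graph (star_nodes r T) (arm r ` T)"
proof -
  define A where "A = {(x, y). \<exists>e\<in>arm r ` T. joins (star_nodes r T) e x y}"
  have "(0, spoke r t) \<in> A" "(spoke r t, 0) \<in> A" if "t \<in> T" for t
    using assms that by (auto simp: A_def joins_arm)
  then have "(u, 0) \<in> A\<^sup>*" "(0, u) \<in> A\<^sup>*" if "u \<in> star_nodes r T" for u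
    using that by (auto simp: star_nodes_def)
  then have "(u, v) \<in> A\<^sup>*" if "u \<in> star_nodes r T" "v \<in> star_nodes r T" for u v
    using that by (meson rtrancl_trans)
  then show ?thesis
    by (auto simp: connected_graph_def A_def star_nodes_def)
qed

text \<open>One of the first two nodes of a cycle is not the center, hence is a tip. It would lie on
  two different edges of the cycle, but a tip lies on its own arm only.\<close>

lemma no_graph_cycle_star:
  assumes "0 < r"
  shows "\<not> graph_cycle (star_nodes r T) (arm r ` T) vs es"
proof
  assume "graph_cycle (star_nodes r T) (arm r ` T) vs es"
  then have len: "2 \<le> length vs" "length es = length vs" and dist: "distinct vs" "distinct es"
    and sub: "set vs \<subseteq> star_nodes r T" "set es \<subseteq> arm r ` T"
    and joins: "\<And>i. i < length vs \<Longrightarrow>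
      joins (star_nodes r T) (es ! i) (vs ! i) (vs ! (Suc i mod length vs))"
    by (auto simp: graph_cycle_def)
  have edge_unique: "e = e'"
    if "e \<in> set es" "e' \<in> set es" "v \<in> star_nodes r T" "v \<noteq> 0" "v \<in> e" "v \<in> e'" for e e' v
  proof -
    from that(3,4) obtain t where "v = spoke r t"
      by (auto simp: star_nodes_def)
    then have "d = arm r t" if "d \<in> set es" "v \<in> d" for d
      using that sub(2) assms by (auto simp: spoke_in_arm_iff)
    then show ?thesis using that by blast
  qed
  have ends: "vs ! i \<in> es ! i" "vs ! (Suc i mod length vs) \<in> es ! i" if "i < length vs" for i
    using joins[OF that] by (auto simp: joins_def)
  have mem: "vs ! i \<in> star_nodes r T" "es ! i \<in> set es" if "i < length vs" for i
    using that len sub by auto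
  show False
  proof (cases "vs ! 0 = 0")
    case True
    then have "vs ! 1 \<noteq> 0"
      using len dist by (metis One_nat_def distinct_conv_nth less_2_cases_iff less_le_trans zero_neq_one)
    moreover have "0 < length vs" "1 < length vs" "Suc 0 mod length vs = 1"
      using len by auto
    then have "vs ! 1 \<in> es ! 0" "vs ! 1 \<in> es ! 1"
      using ends(2)[of 0] ends(1)[of 1] by simp_all
    ultimately have "es ! 0 = es ! 1"
      using \<open>0 < length vs\<close> \<open>1 < length vs\<close> mem edge_unique[of _ _ "vs ! 1"] by metis
    then show False
      using nth_eq_iff_index_eq[OF dist(2), of 0 1] \<open>0 < length vs\<close> \<open>1 < length vs\<close> len(2)
      by simp
  next
    case False
    \<comment> \<open>The edge closing the cycle ends at \<open>vs ! 0\<close>; its index is not 0,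
      as the cycle has at least two edges.\<close>
    define j where "j = length vs - 1"
    have "Suc j = length vs"
      using len(1) by (simp add: j_def)
    then have j: "0 < length vs" "j < length vs" "Suc j mod length vs = 0"
      by auto
    then have "vs ! 0 \<in> es ! 0" "vs ! 0 \<in> es ! j"
      using ends(1)[of 0] ends(2)[of j] by simp_all
    then have "es ! 0 = es ! j"
      using False j(1,2) mem edge_unique[of _ _ "vs ! 0"] by metis
    then show False
      using nth_eq_iff_index_eq[OF dist(2), of 0 j] j(1,2) len by (simp add: j_def)
  qed
qed

text \<open>The tips are always leaves. The center has degree \<open>card T\<close>, so it is a
  further leaf exactly when there is at most one arm: a point has one leaf, a segment two.\<close>

lemma card_leaves_star:
  assumes "finite T" "0 < r"
  shows "card (leaves (star_nodes r T) (arm r ` T)) = (if card T \<le> 1 then Suc (card T) else card T)"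
proof -
  have inj: "inj_on (arm r) T"
  proof (rule inj_onI)
    fix t t' assume "arm r t = arm r t'"
    moreover have "spoke r t \<in> arm r t"
      using assms(2) by (simp add: spoke_in_arm_iff)
    ultimately show "t = t'"
      using assms(2) by (simp add: spoke_in_arm_iff)
  qed
  have deg0: "card {e \<in> arm r ` T. 0 \<in> e} = card T"
  proof -
    have "{e \<in> arm r ` T. 0 \<in> e} = arm r ` T"
      using assms(2) by auto
    then show ?thesis by (simp add: card_image inj)
  qed
  have deg1: "card {e \<in> arm r ` T. spoke r t \<in> e} \<le> 1" if "t \<in> T" for t
  proof -
    have "{e \<in> arm r ` T. spoke r t \<in> e} = {arm r t}"
      using assms(2) that by (auto simp: spoke_in_arm_iff)
    then show ?thesis by simp
  qed
  have "leaves (star_nodes r T) (arm r ` T) =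
      (if card T \<le> 1 then insert 0 (spoke r ` T) else spoke r ` T)"
    using deg0 deg1 by (auto simp: leaves_def star_nodes_def)
  moreover have "card (spoke r ` T) = card T"
    using assms(2) by (intro card_image) (auto simp: inj_on_def spoke_eq_iff)
  moreover have "0 \<notin> spoke r ` T"
    using assms(2) by (auto simp: eq_commute[of 0])
  ultimately show ?thesis
    using assms(1) by auto
qed

lemma tree_space_with_leaves_star:
  assumes "finite T" "0 < r"
  shows "tree_space_with_leaves (top_of_set (star r T))
    (if card T \<le> 1 then Suc (card T) else card T)"
proof -
  have "tree_space (top_of_set (star r T)) (star_nodes r T) (arm r ` T)"
    unfolding tree_space_def
    by (simp add: assms network_space_star connected_graph_star no_graph_cycle_star)
  then show ?thesis
    unfolding tree_space_with_leaves_def using card_leaves_star[OF assms] by metis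
qed

text \<open>The last hypothesis leaves room for the center, which counts as a leaf when there is at
  most one arm.\<close>

lemma tree_in_star:
  assumes "finite T" "0 < r" "star r T \<subseteq> S" "card T \<le> l" "card T \<le> 1 \<Longrightarrow> card T < l"
  shows "tree_in (top_of_set S) l (star r T)"
proof -
  have "subtopology (top_of_set S) (star r T) = top_of_set (star r T)"
    using assms(3) by (simp add: subtopology_subtopology inf_absorb2)
  moreover have "connectedin (top_of_set S) (star r T)"
    using assms by (simp add: connectedin_subtopology connected_star)
  moreover have "(if card T \<le> 1 then Suc (card T) else card T) \<le> l"
    using assms(4,5) by auto
  ultimately show ?thesis
    using tree_space_with_leaves_star[OF assms(1,2)] by (auto simp: tree_in_def)
qed

subsection \<open>Families forcing many colors\<close>

lemma ge_two_if_not_constant: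
  assumes "finite A" "\<not> (\<exists>c. \<forall>x\<in>A. f x = c)"
  shows "2 \<le> card (f ` A)"
proof (rule ccontr)
  assume "\<not> 2 \<le> card (f ` A)"
  then have "card (f ` A) \<le> Suc 0" by simp
  then have "\<forall>x\<in>A. \<forall>y\<in>A. f x = f y"
    using card_le_Suc0_iff_eq[of "f ` A"] assms(1) by (metis finite_imageI imageI)
  then show False
    using assms(2) by metis
qed

text \<open>All objects share the point 0, so two objects already force two colors. This serves the
  degenerate parameters.\<close>

lemma exists_point_family:
  assumes "0 < k" "0 < l"
  shows "\<exists>(X :: complex topology) R. tree_space_with_leaves X k \<and>
    (\<forall>i<n. tree_in X l (R i)) \<and>
    (\<forall>col :: nat \<Rightarrow> nat. nm_coloring {..<n} R col \<longrightarrow> min 2 n \<le> card (col ` {..<n}))"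
proof (intro exI conjI allI impI)
  \<comment> \<open>A single arm would give two leaves, so for \<open>k = 1\<close> the space is a
    point.\<close>
  define T where "T = (if k = 1 then {} else {..<k})"
  let ?X = "top_of_set (star 1 T)" and ?R = "\<lambda>_ :: nat. {0 :: complex}"
  have "finite T" and "(if card T \<le> 1 then Suc (card T) else card T) = k"
    using assms(1) by (auto simp: T_def)
  then show "tree_space_with_leaves ?X k"
    using tree_space_with_leaves_star[of T 1] by simp
  show "tree_in ?X l (?R i)" for i
    using tree_in_star[of "{}" 1 "star 1 T" l] assms(2) by (simp add: star_def)
  show "min 2 n \<le> card (col ` {..<n})" if nm: "nm_coloring {..<n} ?R col" for col :: "nat \<Rightarrow> nat"
  proof (cases "2 \<le> n")
    case True
    have "\<not> (\<exists>c. \<forall>i\<in>{..<n}. col i = c)"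
      using nm[unfolded nm_coloring_def, rule_format, of 0] True by (simp add: Let_def lessThan_def)
    then have "2 \<le> card (col ` {..<n})"
      by (intro ge_two_if_not_constant) auto
    then show ?thesis by simp
  next
    case False
    then consider "n = 0" | "n = 1" by linarith
    then show ?thesis by cases (auto simp: card_gt_0_iff Suc_le_eq lessThan_empty_iff)
  qed
qed

lemma exists_star_family:
  assumes "2 \<le> k" "2 \<le> l" and m: "2 \<le> m" "m \<le> n" "m \<le> l + 1" "m choose 2 \<le> k"
  shows "\<exists>(X :: complex topology) R. tree_space_with_leaves X k \<and>
    (\<forall>i<n. tree_in X l (R i)) \<and> inj_on R {..<n} \<and>
    (\<forall>col :: nat \<Rightarrow> nat. nm_coloring {..<n} R col \<longrightarrow> m \<le> card (col ` {..<n}))"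
proof -
  have "card {e. e \<subseteq> {..<m} \<and> card e = 2} \<le> card {..<k}"
    using m(4) by (simp add: n_subsets)
  \<comment> \<open>\<open>f\<close> assigns to each pair of indices the slope of its private
    arm.\<close>
  then obtain f :: "nat set \<Rightarrow> nat" where f_inj: "inj_on f {e. e \<subseteq> {..<m} \<and> card e = 2}"
    and f_im: "f ` {e. e \<subseteq> {..<m} \<and> card e = 2} \<subseteq> {..<k}"
    by (subst (asm) inj_on_iff_card_le[symmetric]) auto
  have f_less: "f {i, j} < k" if "i < m" "j < m" "i \<noteq> j" for i j
    using f_im that by (auto simp: image_subset_iff)
  have f_eq: "{i, j} = {i', j'}"
    if "f {i, j} = f {i', j'}" "i < m" "j < m" "i \<noteq> j" "i' < m" "j' < m" "i' \<noteq> j'" for i j i' j'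
    using that by (intro inj_onD[OF f_inj]) auto
  define T where "T i = (if i < m then (\<lambda>j. f {i, j}) ` ({..<m} - {i}) else {0})" for i
  \<comment> \<open>Trees with index below \<open>m\<close> reach beyond real part 1 and the fillers
    stay below it. Within each of the two groups the lengths are pairwise different.\<close>
  define r where "r i = (if i < m then real i + 2 else 1 / (real i + 2))" for i
  define R where "R i = star (r i) (T i)" for i
  let ?S = "star (real n + 2) {..<k}"
  have r_pos: "0 < r i" for i by (simp add: r_def)
  have r_inj: "i = j" if "r i = r j" for i j
  proof -
    have "1 < r h \<longleftrightarrow> h < m" for h
      by (simp add: r_def divide_simps)
    then have "i < m \<longleftrightarrow> j < m"
      using that by metis
    then show ?thesis
      using that by (auto simp: r_def split: if_splits)
  qed
  have r_le: "r i \<le> real n + 2" if "i < n" for i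
    using that by (auto simp: r_def divide_simps) (auto simp: algebra_simps)
  have T_sub: "T i \<subseteq> {..<k}" for i
    using f_less assms(1) by (auto simp: T_def)
  have T_fin: "finite (T i)" for i by (simp add: T_def)
  have T_card: "card (T i) \<le> l" for i
  proof (cases "i < m")
    case True
    have "card ((\<lambda>j. f {i, j}) ` ({..<m} - {i})) \<le> card ({..<m} - {i})"
      by (rule card_image_le) simp
    then show ?thesis using True m(3) by (simp add: T_def)
  next
    case False
    then show ?thesis using assms(2) by (simp add: T_def)
  qed
  \<comment> \<open>Without arms a star would not depend on its radius; an arm makes the radius
    recoverable from the point set.\<close>
  have T_ne: "T i \<noteq> {}" for i
  proof -
    have "(if i = 0 then 1 else 0) \<in> {..<m} - {i}"
      using m(1) by auto
    then have "{..<m} - {i} \<noteq> {}" by blast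
    then show ?thesis by (simp add: T_def)
  qed
  have "tree_space_with_leaves (top_of_set ?S) k"
    using tree_space_with_leaves_star[of "{..<k}" "real n + 2"] assms(1) by simp
  moreover have "tree_in (top_of_set ?S) l (R i)" if "i < n" for i
    unfolding R_def using T_fin r_pos star_mono[OF r_le[OF that] T_sub] T_card assms(2)
    by (intro tree_in_star) auto
  moreover have "inj_on R {..<n}"
  proof (rule inj_onI)
    \<comment> \<open>The tip of an arm of \<open>R i\<close> lies in \<open>R j\<close> only if
      \<open>R j\<close> reaches at least as far; equality follows by symmetry.\<close>
    have "r i \<le> r j" if "R i = R j" for i j
    proof -
      obtain t where "t \<in> T i" using T_ne by blast
      then have "spoke (r i) t \<in> R i"
        using r_pos[of i] by (simp add: R_def spoke_in_star_iff)
      then have "spoke (r i) t \<in> R j"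
        using that by simp
      then show ?thesis
        using r_pos[of i] by (simp add: R_def spoke_in_star_iff)
    qed
    then show "i = j" if "R i = R j" for i j
      using that r_inj by (metis order_antisym)
  qed
  moreover have "m \<le> card (col ` {..<n})" if nm: "nm_coloring {..<n} R col" for col :: "nat \<Rightarrow> nat"
  proof -
    have "col i \<noteq> col j" if ij: "i < m" "j < m" "i \<noteq> j" for i j
    proof -
      \<comment> \<open>Real part 1 is beyond every filler and within every other tree that uses
        this arm.\<close>
      define p where "p = spoke 1 (f {i, j})"
      have "p \<in> R h \<longleftrightarrow> h \<in> {i, j}" for h
      proof (cases "h < m")
        case True
        have "f {i, j} \<in> T h \<longleftrightarrow> h \<in> {i, j}"
        proof
          assume "f {i, j} \<in> T h"
          then obtain j' where "j' < m" "j' \<noteq> h" "f {i, j} = f {h, j'}"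
            using True by (auto simp: T_def)
          then have "{i, j} = {h, j'}"
            using f_eq ij True by auto
          then show "h \<in> {i, j}" by auto
        next
          assume "h \<in> {i, j}"
          then show "f {i, j} \<in> T h"
            using ij by (auto simp: T_def insert_commute)
        qed
        then show ?thesis
          using True by (simp add: p_def R_def spoke_in_star_iff r_def)
      next
        case False
        then show ?thesis
          using ij by (auto simp: p_def R_def spoke_in_star_iff r_def)
      qed
      then have "{h \<in> {..<n}. p \<in> R h} = {i, j}"
        using ij m(2) by auto
      \<comment> \<open>Exactly two objects contain \<open>p\<close>, so being non-monochromatic at
        \<open>p\<close> means that their colors differ.\<close>
      then show ?thesis
        using nm[unfolded nm_coloring_def, rule_format, of p] ij by (auto simp: Let_def)
    qed
    then have "inj_on col {..<m}"
      by (auto simp: inj_on_def)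
    then have "m = card (col ` {..<m})"
      by (simp add: card_image)
    also have "\<dots> \<le> card (col ` {..<n})"
      using m(2) by (intro card_mono) auto
    finally show ?thesis .
  qed
  ultimately show ?thesis by blast
qed

section \<open>The triangular root and the choice of the family\<close>

text \<open>The right-hand side is the positive root of \<open>x * (x - 1) = 2 * k\<close>. Squaring
  requires \<open>2 * m - 1\<close> to be nonnegative, so \<open>m = 0\<close> is treated
  apart.\<close>

lemma choose_two_le_if_le_triangular_root:
  assumes "real m \<le> (1 + sqrt (1 + 8 * real k)) / 2"
  shows "m choose 2 \<le> k"
proof (cases "m = 0")
  case False
  have "2 * real m - 1 \<le> sqrt (1 + 8 * real k)"
    using assms by simp
  then have "(2 * real m - 1)\<^sup>2 \<le> (sqrt (1 + 8 * real k))\<^sup>2"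
    using False by (intro power_mono) auto
  then have "real m * (real m - 1) \<le> 2 * real k"
    by (simp add: power2_eq_square algebra_simps)
  then have "real (m * (m - 1)) \<le> real (2 * k)"
    using False by (simp add: of_nat_diff)
  then have "m * (m - 1) \<le> 2 * k"
    by (simp only: of_nat_le_iff)
  then show ?thesis
    by (simp add: choose_two)
qed (simp add: choose_two)

text \<open>Copies of a point settle the cases where a parameter is 1, and the star family settles
  the others. Distinctness is claimed only for \<open>k\<close> and \<open>l\<close> at least 2
  because the copies coincide.\<close>

lemma exists_forcing_family:
  fixes n k l :: nat
  assumes "n > 0" "k > 0" "l > 0"
    and m: "int m = min (int l + 1) (min \<lfloor>(1 + sqrt (1 + 8 * real k)) / 2\<rfloor> (int n))"
  shows "\<exists>(X :: complex topology) R. tree_space_with_leaves X k \<and>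
    (\<forall>i<n. tree_in X l (R i)) \<and> (2 \<le> k \<and> 2 \<le> l \<longrightarrow> inj_on R {..<n}) \<and>
    (\<forall>col :: nat \<Rightarrow> nat. nm_coloring {..<n} R col \<longrightarrow> m \<le> card (col ` {..<n}))"
proof (cases "n = 1 \<or> k = 1 \<or> l = 1")
  case True
  have "\<lfloor>(1 + sqrt (1 + 8 * real k)) / 2\<rfloor> = 2" if "k = 1"
  proof -
    have "sqrt (1 + 8 * real k) = 3"
      using that by (intro real_sqrt_unique) auto
    then show ?thesis by simp
  qed
  then have m_le: "m \<le> min 2 n"
    using True m by auto
  \<comment> \<open>In this case \<open>n = 1\<close>, and any family with a single index is
    injective.\<close>
  have "inj_on R {..<n}" if "2 \<le> k \<and> 2 \<le> l" for R :: "nat \<Rightarrow> complex set"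
    using True that by (auto simp: lessThan_Suc)
  moreover obtain X :: "complex topology" and R where "tree_space_with_leaves X k"
    "\<forall>i<n. tree_in X l (R i)"
    "\<And>col :: nat \<Rightarrow> nat. nm_coloring {..<n} R col \<Longrightarrow> min 2 n \<le> card (col ` {..<n})"
    using exists_point_family[OF assms(2,3), of n] by blast
  ultimately show ?thesis
    using order_trans[OF m_le] by (intro exI[of _ X] exI[of _ R]) blast
next
  case False
  then have ge: "2 \<le> n" "2 \<le> k" "2 \<le> l"
    using assms(1-3) by linarith+
  \<comment> \<open>This makes the root at least 2, hence \<open>m \<ge> 2\<close>, as the star
    family demands.\<close>
  have "3 \<le> sqrt (1 + 8 * real k)"
    using ge(2) by (intro real_le_rsqrt) auto
  then have "2 \<le> \<lfloor>(1 + sqrt (1 + 8 * real k)) / 2\<rfloor>"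
    by (simp add: le_floor_iff)
  then have "2 \<le> int m"
    unfolding m using ge by (intro min.boundedI) linarith+
  moreover have "m \<le> n" "m \<le> l + 1"
    using m by auto
  moreover have "m choose 2 \<le> k"
  proof (rule choose_two_le_if_le_triangular_root)
    have "int m \<le> \<lfloor>(1 + sqrt (1 + 8 * real k)) / 2\<rfloor>"
      using m by simp
    then show "real m \<le> (1 + sqrt (1 + 8 * real k)) / 2"
      by (simp add: le_floor_iff)
  qed
  ultimately show ?thesis
    using exists_star_family[OF ge(2,3), of m n] by auto
qed

section \<open>Passage to the chromatic numbers\<close>

text \<open>Colors that are pairwise different cannot agree on two objects.\<close>

lemma nm_coloring_id: "nm_coloring I R (\<lambda>i. i)"
  unfolding nm_coloring_def Let_def
proof (intro allI impI notI)
  fix p assume "2 \<le> card {i \<in> I. p \<in> R i}" "\<exists>c. \<forall>i\<in>{i \<in> I. p \<in> R i}. i = c"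
  then obtain c where "{i \<in> I. p \<in> R i} \<subseteq> {c}" by blast
  then have "card {i \<in> I. p \<in> R i} \<le> card {c}" by (rule card_mono[rotated]) simp
  with \<open>2 \<le> card {i \<in> I. p \<in> R i}\<close> show False by simp
qed

theorem theorem2:
  fixes n k l :: nat
  assumes "n > 0" and "k > 0" and "l > 0"
  shows "let m = min (int l + 1) (min \<lfloor>(1 + sqrt (1 + 8 * real k)) / 2\<rfloor> (int n)) in
    (\<exists>(X :: complex topology) (I :: nat set) (R :: nat \<Rightarrow> complex set).
        tree_space_with_leaves X k \<and>
        finite I \<and> card I \<le> n \<and> (\<forall>i\<in>I. tree_in X l (R i)) \<and>
        (2 \<le> k \<and> 2 \<le> l \<longrightarrow> inj_on R I) \<and>
        (\<forall>col :: nat \<Rightarrow> nat. nm_coloring I R col \<longrightarrow> m \<le> int (card (col ` I)))) \<and>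
    m \<le> int (chi_NM_tree k l n) \<and>
    (2 \<le> k \<and> 2 \<le> l \<longrightarrow> m \<le> int (chi_NM_tree_distinct k l n))"
proof -
  define M where "M = min (int l + 1) (min \<lfloor>(1 + sqrt (1 + 8 * real k)) / 2\<rfloor> (int n))"
  have "0 \<le> \<lfloor>(1 + sqrt (1 + 8 * real k)) / 2\<rfloor>"
    by (simp add: le_floor_iff)
  then have "0 \<le> M"
    by (simp add: M_def)
  then obtain m where m: "M = int m"
    by (metis nonneg_int_cases)
  obtain X :: "complex topology" and R where X: "tree_space_with_leaves X k"
    and trees: "\<forall>i\<in>{..<n}. tree_in X l (R i)"
    and inj: "2 \<le> k \<and> 2 \<le> l \<longrightarrow> inj_on R {..<n}"
    and forces: "\<And>col :: nat \<Rightarrow> nat. nm_coloring {..<n} R col \<Longrightarrow> m \<le> card (col ` {..<n})"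
    using exists_forcing_family[OF assms, of m] m by (auto simp: M_def)
  \<comment> \<open>\<open>n\<close> colors always suffice, so neither \<open>LEAST\<close> ranges over an empty set.\<close>
  have id: "\<exists>col :: nat \<Rightarrow> nat. nm_coloring I R col \<and> card (col ` I) \<le> n"
    if "card I = n" for I and R :: "nat \<Rightarrow> complex set"
    using that by (intro exI[of _ "\<lambda>i. i"]) (simp add: nm_coloring_id)
  have "m \<le> chi_NM_tree k l n"
    unfolding chi_NM_tree_def
  proof (rule LeastI2[of _ n])
    fix c assume "\<forall>(X :: complex topology) j (I :: nat set) R.
       j \<le> k \<and> tree_space_with_leaves X j \<and>
       finite I \<and> card I = n \<and> (\<forall>i\<in>I. tree_in X l (R i)) \<longrightarrow>
       (\<exists>col :: nat \<Rightarrow> nat. nm_coloring I R col \<and> card (col ` I) \<le> c)"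
    \<comment> \<open>Any admissible \<open>c\<close> must in particular suffice for the forcing
      family, which needs \<open>m\<close> colors.\<close>
    from this[rule_format, of k X "{..<n}" R] obtain col :: "nat \<Rightarrow> nat"
      where "nm_coloring {..<n} R col" "card (col ` {..<n}) \<le> c"
      using X trees by auto
    with forces show "m \<le> c" by (meson order_trans)
  qed (use id in blast)
  moreover have "m \<le> chi_NM_tree_distinct k l n" if kl: "2 \<le> k \<and> 2 \<le> l"
    unfolding chi_NM_tree_distinct_def
  proof (rule LeastI2[of _ n])
    fix c assume "\<forall>(X :: complex topology) j (I :: nat set) R.
       j \<le> k \<and> tree_space_with_leaves X j \<and>
       finite I \<and> card I = n \<and> inj_on R I \<and> (\<forall>i\<in>I. tree_in X l (R i)) \<longrightarrow>
       (\<exists>col :: nat \<Rightarrow> nat. nm_coloring I R col \<and> card (col ` I) \<le> c)"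
    from this[rule_format, of k X "{..<n}" R] obtain col :: "nat \<Rightarrow> nat"
      where "nm_coloring {..<n} R col" "card (col ` {..<n}) \<le> c"
      using X trees inj kl by auto
    with forces show "m \<le> c" by (meson order_trans)
  qed (use id in blast)
  moreover have "\<exists>(X :: complex topology) (I :: nat set) (R :: nat \<Rightarrow> complex set).
        tree_space_with_leaves X k \<and>
        finite I \<and> card I \<le> n \<and> (\<forall>i\<in>I. tree_in X l (R i)) \<and>
        (2 \<le> k \<and> 2 \<le> l \<longrightarrow> inj_on R I) \<and>
        (\<forall>col :: nat \<Rightarrow> nat. nm_coloring I R col \<longrightarrow> M \<le> int (card (col ` I)))"
    using X trees inj forces m by (intro exI[of _ X] exI[of _ "{..<n}"] exI[of _ R]) auto
  ultimately show ?thesis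
    unfolding Let_def M_def[symmetric] using m by simp
qed

end
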